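(* Let $K$ be a field, let $P=K[x_1,\dots,x_n]$, and let $f_1,\dots,f_n\in K[t_1,\dots,t_s]\setminus K$. Let $h$ be a new indeterminate, and let $P[t_1,\dots,t_s,h]$ be graded by setting $\deg(x_i)=\deg(f_i)$ for $i=1,\dots,n$ and $\deg(t_1)=\cdots=\deg(t_s)=\deg(h)=1$. Let $F_i=f_i^{\mathrm{hom}}\in K[t_1,\dots,t_s,h]$ be the homogenization of $f_i$ with respect to $h$, and let $\bar J=\langle x_1-F_1,\dots,x_n-F_n\rangle\subseteq P[t_1,\dots,t_s,h]$ be the eliminating ideal of $(F_1,\dots,F_n)$. Then: (a) The ideal $\bar J\cap P[h]$ is prime. (b) $\mathrm{Implicit}(f_1,\dots,f_n)=(\bar J\cap P[h])^{\mathrm{deh}}$.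
   Context: Here $t_1,\dots,t_s$ and $x_1,\dots,x_n$ are distinct indeterminates. $\mathrm{Implicit}(f_1,\dots,f_n)\subseteq P$ denotes the kernel of the $K$-algebra homomorphism $P\to K[t_1,\dots,t_s]$ sending $x_i\mapsto f_i$ for $i=1,\dots,n$. The degree $\deg(f_i)$ is the usual total degree in $t_1,\dots,t_s$. The homogenization $f_i^{\mathrm{hom}}$ is obtained by multiplying each monomial of $f_i$ by the power of $h$ that makes its degree equal to $\deg(f_i)$. For an ideal $I$ of a polynomial ring containing $h$, $I^{\mathrm{deh}}$ is its dehomogenization with respect to $h$, i.e. the ideal $\{F|_{h=1} : F\in I\}$ of the polynomial ring without $h$ (so $(\bar J\cap P[h])^{\mathrm{deh}}\subseteq P$). *)

theory Defs
  imports "HOL-Library.Poly_Mapping" "HOL-Algebra.Ideal"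
begin

text \<open>
  All polynomial rings of the statement are realised inside one type of polynomials with
  coefficients in a field, as the subrings of those polynomials that involve only a given
  set of indeterminates. A monomial is its exponent vector, and a polynomial is a finitely
  supported function from monomials to coefficients, with the convolution product of
  \<^theory>\<open>HOL-Library.Poly_Mapping\<close>.
\<close>

datatype indet = XVar nat | TVar nat | HVar

type_synonym monom = "indet \<Rightarrow>\<^sub>0 nat"

type_synonym 'k mpoly = "monom \<Rightarrow>\<^sub>0 'k"

definition const :: "'k \<Rightarrow> 'k::comm_ring_1 mpoly" where
  "const c = Poly_Mapping.single 0 c"

definition indet_poly :: "indet \<Rightarrow> 'k::comm_ring_1 mpoly" where
  "indet_poly v = Poly_Mapping.single (Poly_Mapping.single v 1) 1"

definition indets :: "'k::zero mpoly \<Rightarrow> indet set" where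
  "indets p = (\<Union>m\<in>Poly_Mapping.keys p. Poly_Mapping.keys m)"

definition poly_ring :: "indet set \<Rightarrow> 'k::comm_ring_1 mpoly ring" where
  "poly_ring V = \<lparr>carrier = {p. indets p \<subseteq> V}, monoid.mult = (*), one = 1, zero = 0, add = (+)\<rparr>"

definition xvars :: "nat \<Rightarrow> indet set" where
  "xvars n = XVar ` {1..n}"

definition tvars :: "nat \<Rightarrow> indet set" where
  "tvars s = TVar ` {1..s}"

text \<open>The homomorphism of algebras over the coefficient ring that sends each indeterminate
  \<open>v\<close> to \<open>\<sigma> v\<close>.\<close>

definition mpoly_subst :: "(indet \<Rightarrow> 'k mpoly) \<Rightarrow> 'k mpoly \<Rightarrow> 'k::comm_ring_1 mpoly" where
  "mpoly_subst \<sigma> p =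
    (\<Sum>m\<in>Poly_Mapping.keys p. const (Poly_Mapping.lookup p m) *
       (\<Prod>v\<in>Poly_Mapping.keys m. \<sigma> v ^ Poly_Mapping.lookup m v))"

definition monom_degree :: "monom \<Rightarrow> nat" where
  "monom_degree m = (\<Sum>v\<in>Poly_Mapping.keys m. Poly_Mapping.lookup m v)"

text \<open>The zero polynomial gets degree \<open>0\<close>; only nonconstant polynomials matter below.\<close>

definition total_degree :: "'k::zero mpoly \<Rightarrow> nat" where
  "total_degree p = Max (insert 0 (monom_degree ` Poly_Mapping.keys p))"

text \<open>The truncated subtraction is exact here, since no monomial of \<open>p\<close> has degree larger
  than that of \<open>p\<close>.\<close>

definition homogenize :: "'k mpoly \<Rightarrow> 'k::comm_ring_1 mpoly" where
  "homogenize p =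
    (\<Sum>m\<in>Poly_Mapping.keys p.
       Poly_Mapping.single (m + Poly_Mapping.single HVar (total_degree p - monom_degree m))
         (Poly_Mapping.lookup p m))"

definition dehomogenize :: "'k mpoly \<Rightarrow> 'k::comm_ring_1 mpoly" where
  "dehomogenize = mpoly_subst (\<lambda>v. if v = HVar then 1 else indet_poly v)"

text \<open>Only the values of the substitution at the \<open>XVar i\<close> with \<open>1 \<le> i \<le> n\<close> matter,
  because the homomorphism is considered on \<open>poly_ring (xvars n)\<close>.\<close>

definition implicit :: "nat \<Rightarrow> nat \<Rightarrow> (nat \<Rightarrow> 'k mpoly) \<Rightarrow> 'k::comm_ring_1 mpoly set" where
  "implicit n s f =
    a_kernel (poly_ring (xvars n)) (poly_ring (tvars s))
      (mpoly_subst (\<lambda>v. case v of XVar i \<Rightarrow> f i | _ \<Rightarrow> 0))"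

text \<open>The grading with \<open>deg x\<^sub>i = deg f\<^sub>i\<close> and \<open>deg t\<^sub>j = deg h = 1\<close> makes this ideal homogeneous when
  \<open>F i\<close> is the homogenization of \<open>f i\<close>, but enters neither its definition nor those of
  homogenization and dehomogenization.\<close>

definition eliminating_ideal ::
    "nat \<Rightarrow> nat \<Rightarrow> (nat \<Rightarrow> 'k mpoly) \<Rightarrow> 'k::comm_ring_1 mpoly set" where
  "eliminating_ideal n s F =
    genideal (poly_ring (xvars n \<union> tvars s \<union> {HVar})) {indet_poly (XVar i) - F i | i. i \<in> {1..n}}"

end

theory Submission
  imports Defs "HOL-Algebra.RingHom" "HOL-Library.Countable"
begin

text \<open>
  Let \<open>\<Phi>\<close> be the substitution \<open>x\<^sub>i \<mapsto> F\<^sub>i\<close> that fixes all \<open>t\<^sub>j\<close> and \<open>h\<close>. Everything rests on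
  the fact that the eliminating ideal is the kernel of \<open>\<Phi>\<close> (\<open>eliminating_ideal_eq_kernel\<close>):
  modulo the ideal every \<open>x\<^sub>i\<close> equals \<open>F\<^sub>i\<close>, so every polynomial is congruent to its image
  under \<open>\<Phi>\<close>. Hence the elimination ideal in \<open>P[h]\<close> is the kernel of \<open>\<Phi>\<close> on \<open>P[h]\<close>, and it is
  prime since \<open>\<Phi>\<close> takes values in a ring without zero divisors.

  For the description of the implicit ideal, \<open>\<Phi>\<close> followed by \<open>h = 1\<close> agrees on \<open>P[h]\<close> with
  \<open>h = 1\<close> followed by \<open>x\<^sub>i \<mapsto> f\<^sub>i\<close>, because dehomogenizing \<open>F\<^sub>i\<close> gives back \<open>f\<^sub>i\<close>. So the
  dehomogenization of an element of the kernel of \<open>\<Phi>\<close> is a relation between the \<open>f\<^sub>i\<close>.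
  Conversely, a relation \<open>p\<close> is homogenized to some \<open>P\<close> with respect to the weights
  \<open>deg f\<^sub>i\<close> of the \<open>x\<^sub>i\<close> (\<open>weighted_homogenization_exists\<close>). Then \<open>\<Phi> P\<close> is homogeneous
  and vanishes at \<open>h = 1\<close>, and a homogeneous polynomial with this property is zero
  (\<open>homogeneous_dehomogenize_eq_0D\<close>), so \<open>P\<close> lies in the kernel of \<open>\<Phi>\<close>.
\<close>

section \<open>Polynomials over a field have no zero divisors\<close>

text \<open>A polynomial ring over a domain has no zero divisors, because leading monomials multiply.
  The instance of \<^class>\<open>idom\<close> for \<^type>\<open>poly_mapping\<close> takes the monomial order from a linear
  order on the indeterminates. Any such order serves; the one chosen here comes from an
  enumeration of the indeterminates.\<close>

instance indet :: countable
  by countable_datatype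

instantiation indet :: linorder
begin

definition less_eq_indet :: "indet \<Rightarrow> indet \<Rightarrow> bool" where
  "less_eq_indet u v \<longleftrightarrow> to_nat u \<le> to_nat v"

definition less_indet :: "indet \<Rightarrow> indet \<Rightarrow> bool" where
  "less_indet u v \<longleftrightarrow> to_nat u < to_nat v"

instance
  by standard (auto simp: less_eq_indet_def less_indet_def)

end

section \<open>The polynomial rings on sets of indeterminates\<close>

lemma carrier_poly_ring [simp]: "carrier (poly_ring V) = {p. indets p \<subseteq> V}"
  and mult_poly_ring [simp]: "mult (poly_ring V) = (*)"
  and one_poly_ring [simp]: "one (poly_ring V) = 1"
  and zero_poly_ring [simp]: "zero (poly_ring V) = 0"
  and add_poly_ring [simp]: "add (poly_ring V) = (+)"
  by (simp_all add: poly_ring_def)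

lemma keys_add_nat:
  fixes a b :: "'a \<Rightarrow>\<^sub>0 nat"
  shows "Poly_Mapping.keys (a + b) = Poly_Mapping.keys a \<union> Poly_Mapping.keys b"
  by (auto simp: in_keys_iff lookup_add)

lemma indets_0 [simp]: "indets 0 = {}"
  by (simp add: indets_def)

lemma indets_1 [simp]: "indets (1 :: 'k::comm_ring_1 mpoly) = {}"
  by (simp add: indets_def)

lemma indets_const [simp]: "indets (const c) = {}"
  by (simp add: indets_def const_def)

lemma indets_indet_poly [simp]: "indets (indet_poly v :: 'k::comm_ring_1 mpoly) = {v}"
  by (simp add: indets_def indet_poly_def)

lemma indets_add: "indets (p + q) \<subseteq> indets p \<union> indets q"
  using keys_add[of p q] by (auto simp: indets_def)

lemma indets_uminus [simp]: "indets (- p :: 'k::comm_ring_1 mpoly) = indets p"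
  by (simp add: indets_def)

lemma indets_diff: "indets (p - q :: 'k::comm_ring_1 mpoly) \<subseteq> indets p \<union> indets q"
  using indets_add[of p "- q"] by simp

lemma indets_mult: "indets (p * q :: 'k::comm_ring_1 mpoly) \<subseteq> indets p \<union> indets q"
  using keys_mult[of p q] by (fastforce simp: indets_def keys_add_nat)

lemma indets_power: "indets (p ^ k :: 'k::comm_ring_1 mpoly) \<subseteq> indets p"
  by (induction k) (use indets_mult in fastforce)+

lemma indets_sum: "indets (sum f A) \<subseteq> (\<Union>a\<in>A. indets (f a))"
  by (induction A rule: infinite_finite_induct) (use indets_add in fastforce)+

lemma const_0 [simp]: "const 0 = 0"
  and const_1 [simp]: "const 1 = 1"
  and const_add: "const (a + b) = const a + const b"
  and const_mult: "const (a * b) = const a * const b"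
  by (simp_all add: const_def single_add mult_single)

lemma indets_add_subset: "indets p \<subseteq> V \<Longrightarrow> indets q \<subseteq> V \<Longrightarrow> indets (p + q) \<subseteq> V"
  using indets_add by blast

lemma indets_mult_subset:
  "indets p \<subseteq> V \<Longrightarrow> indets q \<subseteq> V \<Longrightarrow> indets (p * q :: 'k::comm_ring_1 mpoly) \<subseteq> V"
  using indets_mult by blast

lemma cring_poly_ring: "cring (poly_ring V :: 'k::comm_ring_1 mpoly ring)"
proof (rule cringI)
  show "abelian_group (poly_ring V :: 'k mpoly ring)"
  proof (rule abelian_groupI)
    fix p assume "p \<in> carrier (poly_ring V :: 'k mpoly ring)"
    then show "\<exists>q\<in>carrier (poly_ring V). q \<oplus>\<^bsub>poly_ring V\<^esub> p = \<zero>\<^bsub>poly_ring V\<^esub>"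
      by (intro bexI[of _ "- p"]) auto
  qed (simp_all add: indets_add_subset add.assoc add.commute)
  show "comm_monoid (poly_ring V :: 'k mpoly ring)"
    by (rule comm_monoidI) (simp_all add: indets_mult_subset mult.assoc mult.commute)
qed (simp add: distrib_right)

section \<open>Substitution\<close>

definition monom_subst :: "(indet \<Rightarrow> 'k mpoly) \<Rightarrow> monom \<Rightarrow> 'k::comm_ring_1 mpoly" where
  "monom_subst \<sigma> m = (\<Prod>v\<in>Poly_Mapping.keys m. \<sigma> v ^ Poly_Mapping.lookup m v)"

lemma monom_subst_superset:
  assumes "finite A" "Poly_Mapping.keys m \<subseteq> A"
  shows "monom_subst \<sigma> m = (\<Prod>v\<in>A. \<sigma> v ^ Poly_Mapping.lookup m v)"
  unfolding monom_subst_def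
  by (rule prod.mono_neutral_left) (use assms in \<open>auto simp: in_keys_iff\<close>)

lemma monom_subst_0 [simp]: "monom_subst \<sigma> 0 = 1"
  by (simp add: monom_subst_def)

lemma monom_subst_add: "monom_subst \<sigma> (a + b) = monom_subst \<sigma> a * monom_subst \<sigma> b"
  using monom_subst_superset[of "Poly_Mapping.keys a \<union> Poly_Mapping.keys b" _ \<sigma>]
  by (simp add: keys_add_nat lookup_add power_add prod.distrib)

lemma monom_subst_single: "monom_subst \<sigma> (Poly_Mapping.single v k) = \<sigma> v ^ k"
  by (simp add: monom_subst_def)

lemma mpoly_subst_eq:
  "mpoly_subst \<sigma> p =
     (\<Sum>m\<in>Poly_Mapping.keys p. const (Poly_Mapping.lookup p m) * monom_subst \<sigma> m)"
  by (simp add: mpoly_subst_def monom_subst_def)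

lemma mpoly_subst_add: "mpoly_subst \<sigma> (p + q) = mpoly_subst \<sigma> p + mpoly_subst \<sigma> q"
  unfolding mpoly_subst_eq
  by (rule setsum_keys_plus_distrib) (simp_all add: const_add distrib_right)

lemma mpoly_subst_single: "mpoly_subst \<sigma> (Poly_Mapping.single m c) = const c * monom_subst \<sigma> m"
  by (simp add: mpoly_subst_eq)

lemma mpoly_subst_0 [simp]: "mpoly_subst \<sigma> 0 = 0"
  by (simp add: mpoly_subst_eq)

lemma mpoly_subst_const [simp]: "mpoly_subst \<sigma> (const c) = const c"
  by (simp add: const_def mpoly_subst_single)

lemma mpoly_subst_1 [simp]: "mpoly_subst \<sigma> 1 = 1"
  using mpoly_subst_const[of \<sigma> 1] by (simp del: mpoly_subst_const)

lemma mpoly_subst_indet_poly [simp]: "mpoly_subst \<sigma> (indet_poly v) = \<sigma> v"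
  by (simp add: indet_poly_def mpoly_subst_single monom_subst_single)

lemma mpoly_subst_sum: "mpoly_subst \<sigma> (sum f A) = (\<Sum>a\<in>A. mpoly_subst \<sigma> (f a))"
  by (induction A rule: infinite_finite_induct) (simp_all add: mpoly_subst_add)

lemma sum_monomials:
  "(\<Sum>m\<in>Poly_Mapping.keys p. Poly_Mapping.single m (Poly_Mapping.lookup p m)) = p"
  by (rule poly_mapping_eqI)
     (simp add: lookup_sum lookup_single when_def in_keys_iff)

text \<open>Both sides are biadditive in \<open>p\<close> and \<open>q\<close>, so it is enough to compare them on single terms,
  where \<open>monom_subst_add\<close> applies.\<close>

lemma mpoly_subst_mult: "mpoly_subst \<sigma> (p * q) = mpoly_subst \<sigma> p * mpoly_subst \<sigma> q"
proof -
  have single: "mpoly_subst \<sigma> (Poly_Mapping.single a c * Poly_Mapping.single b d)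
      = mpoly_subst \<sigma> (Poly_Mapping.single a c) * mpoly_subst \<sigma> (Poly_Mapping.single b d)"
    for a b c d
    by (simp add: mult_single mpoly_subst_single monom_subst_add const_mult)
  have "mpoly_subst \<sigma>
         ((\<Sum>m\<in>Poly_Mapping.keys p. Poly_Mapping.single m (Poly_Mapping.lookup p m)) *
          (\<Sum>m\<in>Poly_Mapping.keys q. Poly_Mapping.single m (Poly_Mapping.lookup q m)))
      = mpoly_subst \<sigma> (\<Sum>m\<in>Poly_Mapping.keys p. Poly_Mapping.single m (Poly_Mapping.lookup p m)) *
        mpoly_subst \<sigma> (\<Sum>m\<in>Poly_Mapping.keys q. Poly_Mapping.single m (Poly_Mapping.lookup q m))"
    by (simp add: sum_product mpoly_subst_sum single)
  then show ?thesis
    by (simp only: sum_monomials)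
qed

lemma mpoly_subst_power: "mpoly_subst \<sigma> (p ^ k) = mpoly_subst \<sigma> p ^ k"
  by (induction k) (simp_all add: mpoly_subst_mult)

lemma mpoly_subst_uminus: "mpoly_subst \<sigma> (- p) = - mpoly_subst \<sigma> p"
  using mpoly_subst_add[of \<sigma> p "- p"] by (simp add: eq_neg_iff_add_eq_0 add.commute)

lemma mpoly_subst_diff: "mpoly_subst \<sigma> (p - q) = mpoly_subst \<sigma> p - mpoly_subst \<sigma> q"
  using mpoly_subst_add[of \<sigma> p "- q"] by (simp add: mpoly_subst_uminus)

lemma mpoly_subst_cong:
  assumes "\<And>v. v \<in> indets p \<Longrightarrow> \<sigma> v = \<tau> v"
  shows "mpoly_subst \<sigma> p = mpoly_subst \<tau> p"
proof -
  have "monom_subst \<sigma> m = monom_subst \<tau> m" if "m \<in> Poly_Mapping.keys p" for m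
  proof -
    have "\<sigma> v = \<tau> v" if "v \<in> Poly_Mapping.keys m" for v
      using assms \<open>m \<in> Poly_Mapping.keys p\<close> that by (auto simp: indets_def)
    then show ?thesis
      by (simp add: monom_subst_def)
  qed
  then show ?thesis
    by (simp add: mpoly_subst_eq)
qed

lemma monom_subst_indet_poly:
  "monom_subst indet_poly m = (Poly_Mapping.single m 1 :: 'k::comm_ring_1 mpoly)"
proof -
  have pow: "(indet_poly v :: 'k mpoly) ^ k = Poly_Mapping.single (Poly_Mapping.single v k) 1" for v k
    by (induction k) (simp_all add: indet_poly_def mult_single flip: Poly_Mapping.single_add)
  have "(\<Prod>v\<in>A. indet_poly v ^ Poly_Mapping.lookup m v) =
      (Poly_Mapping.single (\<Sum>v\<in>A. Poly_Mapping.single v (Poly_Mapping.lookup m v)) 1 :: 'k mpoly)"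
    if "finite A" for A
    using that
    by (induction A rule: finite_induct)
       (simp_all add: pow mult_single)
  then show ?thesis
    by (simp add: monom_subst_def sum_monomials)
qed

text \<open>The ring on \<open>V\<close> is generated by the constants and the indeterminates in \<open>V\<close>. As an induction
  rule, this lets identities between substitutions be checked on generators alone.\<close>

lemma poly_ring_induct [consumes 1, case_names const indet add mult]:
  fixes p :: "'k::comm_ring_1 mpoly"
  assumes p: "p \<in> carrier (poly_ring V)"
    and const: "\<And>c. P (const c)"
    and indet: "\<And>v. v \<in> V \<Longrightarrow> P (indet_poly v)"
    and add: "\<And>p q. \<lbrakk>p \<in> carrier (poly_ring V); q \<in> carrier (poly_ring V); P p; P q\<rbrakk> \<Longrightarrow> P (p + q)"
    and mult: "\<And>p q. \<lbrakk>p \<in> carrier (poly_ring V); q \<in> carrier (poly_ring V); P p; P q\<rbrakk> \<Longrightarrow> P (p * q)"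
  shows "P p"
proof -
  let ?Q = "\<lambda>p. indets p \<subseteq> V \<and> P p"
  have Qconst: "?Q (const c)" for c
    by (simp add: const)
  have Qadd: "?Q (p + q)" if "?Q p" "?Q q" for p q
    using that add indets_add[of p q] by auto
  have Qmult: "?Q (p * q)" if "?Q p" "?Q q" for p q
    using that mult indets_mult[of p q] by auto
  have Qpow: "?Q (indet_poly v ^ k)" if "v \<in> V" for v k
  proof (induction k)
    case 0
    show ?case using Qconst[of 1] by simp
  next
    case (Suc k)
    then show ?case using Qmult indet[OF that] that by simp
  qed
  have Qprod: "?Q (\<Prod>v\<in>A. indet_poly v ^ e v)" if "finite A" "A \<subseteq> V" for A and e :: "indet \<Rightarrow> nat"
    using that
  proof (induction A rule: finite_induct)
    case empty
    show ?case using Qconst[of 1] by simp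
  next
    case (insert v A)
    then show ?case using Qmult[OF Qpow[of v "e v"]] by simp
  qed
  have Qsum: "?Q (\<Sum>m\<in>M. const (c m) * monom_subst indet_poly m)"
    if "finite M" "\<And>m. m \<in> M \<Longrightarrow> Poly_Mapping.keys m \<subseteq> V" for M c
    using that
  proof (induction M rule: finite_induct)
    case empty
    show ?case using Qconst[of 0] by simp
  next
    case (insert m M)
    have "?Q (monom_subst indet_poly m)"
      unfolding monom_subst_def by (rule Qprod) (use insert.prems in auto)
    then have "?Q (const (c m) * monom_subst indet_poly m)"
      by (rule Qmult[OF Qconst])
    moreover have "?Q (\<Sum>m\<in>M. const (c m) * monom_subst indet_poly m)"
      by (rule insert.IH) (use insert.prems in auto)
    ultimately show ?case
      using Qadd insert.hyps by simp
  qed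
  have "p = (\<Sum>m\<in>Poly_Mapping.keys p. const (Poly_Mapping.lookup p m) * monom_subst indet_poly m)"
    by (simp add: monom_subst_indet_poly const_def mult_single sum_monomials)
  moreover have "?Q \<dots>"
    by (rule Qsum) (use p in \<open>auto simp: indets_def\<close>)
  ultimately show ?thesis by simp
qed

lemma mpoly_subst_mpoly_subst:
  "mpoly_subst \<sigma> (mpoly_subst \<tau> p) = mpoly_subst (\<lambda>v. mpoly_subst \<sigma> (\<tau> v)) p"
proof -
  have "p \<in> carrier (poly_ring UNIV)" by simp
  then show ?thesis
    by (induction p rule: poly_ring_induct) (simp_all add: mpoly_subst_add mpoly_subst_mult)
qed

lemma mpoly_subst_id:
  assumes "\<And>v. v \<in> indets p \<Longrightarrow> \<sigma> v = indet_poly v"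
  shows "mpoly_subst \<sigma> p = p"
proof -
  have "p \<in> carrier (poly_ring (indets p))" by simp
  then show ?thesis
    by (induction p rule: poly_ring_induct) (simp_all add: mpoly_subst_add mpoly_subst_mult assms)
qed

lemma mpoly_subst_closed:
  assumes "p \<in> carrier (poly_ring V)" "\<And>v. v \<in> V \<Longrightarrow> \<sigma> v \<in> carrier (poly_ring W)"
  shows "mpoly_subst \<sigma> p \<in> carrier (poly_ring W)"
  using assms(1)
proof (induction p rule: poly_ring_induct)
  case (indet v)
  then show ?case using assms(2) by simp
next
  case (add p q)
  then show ?case by (simp add: mpoly_subst_add indets_add_subset)
next
  case (mult p q)
  then show ?case by (simp add: mpoly_subst_mult indets_mult_subset)
qed simp

lemma ring_hom_mpoly_subst:
  "ring_hom_ring (poly_ring V) (poly_ring UNIV) (mpoly_subst \<sigma> :: 'k::comm_ring_1 mpoly \<Rightarrow> _)"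
  by (rule ring_hom_ringI)
     (simp_all add: cring.axioms(1)[OF cring_poly_ring] mpoly_subst_add mpoly_subst_mult)

definition mpoly_subst_kernel :: "indet set \<Rightarrow> (indet \<Rightarrow> 'k mpoly) \<Rightarrow> 'k::comm_ring_1 mpoly set" where
  "mpoly_subst_kernel V \<sigma> = {p \<in> carrier (poly_ring V). mpoly_subst \<sigma> p = 0}"

lemma ideal_mpoly_subst_kernel: "ideal (mpoly_subst_kernel V \<sigma>) (poly_ring V)"
  using ring_hom_ring.kernel_is_ideal[OF ring_hom_mpoly_subst, of V \<sigma>]
  by (simp add: a_kernel_def' mpoly_subst_kernel_def)

text \<open>The ideal is the preimage of the zero ideal of a domain; it is proper because \<open>1\<close> is mapped
  to \<open>1\<close>.\<close>

lemma primeideal_mpoly_subst_kernel: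
  fixes \<sigma> :: "indet \<Rightarrow> 'k::field mpoly"
  shows "primeideal (mpoly_subst_kernel V \<sigma>) (poly_ring V)"
proof (rule primeidealI)
  show "carrier (poly_ring V) \<noteq> mpoly_subst_kernel V \<sigma>"
  proof
    assume "carrier (poly_ring V) = mpoly_subst_kernel V \<sigma>"
    moreover have "1 \<in> carrier (poly_ring V :: 'k mpoly ring)" by simp
    ultimately show False by (auto simp: mpoly_subst_kernel_def)
  qed
qed (rule ideal_mpoly_subst_kernel cring_poly_ring |
     auto simp: mpoly_subst_kernel_def mpoly_subst_mult)+

section \<open>The eliminating ideal\<close>

definition graph_subst :: "(nat \<Rightarrow> 'k mpoly) \<Rightarrow> indet \<Rightarrow> 'k::comm_ring_1 mpoly" where
  "graph_subst F v = (case v of XVar i \<Rightarrow> F i | _ \<Rightarrow> indet_poly v)"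

lemma ideal_poly_ring_add:
  assumes "ideal I (poly_ring V)" "p \<in> I" "q \<in> I"
  shows "p + q \<in> I"
  using additive_subgroup.a_closed[OF ideal.axioms(1)[OF assms(1)] assms(2,3)] by simp

lemma ideal_poly_ring_mult:
  assumes "ideal I (poly_ring V)" "p \<in> I" "q \<in> carrier (poly_ring V)"
  shows "q * p \<in> I"
  using ideal.I_l_closed[OF assms] by simp

text \<open>Since the \<open>F i\<close> do not involve the \<open>XVar i\<close>, the substitution fixes them and so kills the
  generators of the ideal. For the other inclusion, the difference of a polynomial and its image
  lies in the ideal: this is clear for constants and indeterminates, and it is inherited by
  sums and products.\<close>

lemma eliminating_ideal_eq_kernel:
  fixes F :: "nat \<Rightarrow> 'k::comm_ring_1 mpoly"
  assumes F: "\<And>i. i \<in> {1..n} \<Longrightarrow> F i \<in> carrier (poly_ring (tvars s \<union> {HVar}))"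
  shows "eliminating_ideal n s F =
    mpoly_subst_kernel (xvars n \<union> tvars s \<union> {HVar}) (graph_subst F)"
proof
  let ?V = "xvars n \<union> tvars s \<union> {HVar}"
  let ?R = "poly_ring ?V :: 'k mpoly ring"
  let ?S = "{indet_poly (XVar i) - F i | i. i \<in> {1..n}}"
  let ?\<phi> = "mpoly_subst (graph_subst F)"
  interpret R: cring ?R by (rule cring_poly_ring)
  have \<phi>F: "?\<phi> (F i) = F i" if "i \<in> {1..n}" for i
    by (rule mpoly_subst_id) (use F[OF that] in \<open>auto simp: graph_subst_def tvars_def\<close>)
  have indets_gen: "indets (indet_poly (XVar i) - F i) \<subseteq> ?V" if "i \<in> {1..n}" for i
    using indets_diff[of "indet_poly (XVar i)" "F i"] F[OF that] that by (auto simp: xvars_def)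
  have S: "?S \<subseteq> carrier ?R"
    using indets_gen by auto
  have "?S \<subseteq> mpoly_subst_kernel ?V (graph_subst F)"
    using S by (auto simp: mpoly_subst_kernel_def mpoly_subst_diff \<phi>F) (simp add: graph_subst_def)
  then show "eliminating_ideal n s F \<subseteq> mpoly_subst_kernel ?V (graph_subst F)"
    unfolding eliminating_ideal_def by (rule R.genideal_minimal[OF ideal_mpoly_subst_kernel])
  let ?J = "eliminating_ideal n s F"
  have J: "ideal ?J ?R"
    unfolding eliminating_ideal_def by (rule R.genideal_ideal[OF S])
  have J0: "0 \<in> ?J"
    using additive_subgroup.zero_closed[OF ideal.axioms(1)[OF J]] by simp
  have \<phi>_closed: "?\<phi> p \<in> carrier ?R" if "p \<in> carrier ?R" for p
  proof (rule mpoly_subst_closed[OF that])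
    fix v assume "v \<in> ?V"
    then consider i where "i \<in> {1..n}" "v = XVar i" | "v \<in> tvars s \<union> {HVar}"
      by (auto simp: xvars_def)
    then show "graph_subst F v \<in> carrier ?R"
    proof cases
      case 1
      then show ?thesis using F[OF 1(1)] by (auto simp: graph_subst_def)
    next
      case 2
      then show ?thesis by (auto simp: graph_subst_def tvars_def)
    qed
  qed
  have "p - ?\<phi> p \<in> ?J" if "p \<in> carrier ?R" for p
    using that
  proof (induction p rule: poly_ring_induct)
    case (const c)
    show ?case using J0 by simp
  next
    case (indet v)
    show ?case
    proof (cases "v \<in> xvars n")
      case True
      then obtain i where i: "i \<in> {1..n}" "v = XVar i" by (auto simp: xvars_def)
      then have "indet_poly v - ?\<phi> (indet_poly v) \<in> ?S" by (auto simp: graph_subst_def)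
      then show ?thesis
        unfolding eliminating_ideal_def using R.genideal_self[OF S] by blast
    next
      case False
      then show ?thesis using indet J0 by (auto simp: graph_subst_def tvars_def)
    qed
  next
    case (add p q)
    have "(p + q) - ?\<phi> (p + q) = (p - ?\<phi> p) + (q - ?\<phi> q)"
      by (simp add: mpoly_subst_add)
    then show ?case using ideal_poly_ring_add[OF J add.IH] by (simp only:)
  next
    case (mult p q)
    \<comment> \<open>Replace the factors one after the other by their images.\<close>
    have "p * q - ?\<phi> (p * q) = q * (p - ?\<phi> p) + ?\<phi> p * (q - ?\<phi> q)"
      by (simp add: mpoly_subst_mult algebra_simps)
    then show ?case
      using ideal_poly_ring_add[OF J] ideal_poly_ring_mult[OF J] mult \<phi>_closed by simp
  qed
  then show "mpoly_subst_kernel ?V (graph_subst F) \<subseteq> ?J"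
    by (force simp: mpoly_subst_kernel_def)
qed

section \<open>Homogeneous polynomials and dehomogenization\<close>

definition homogeneous :: "nat \<Rightarrow> 'k::zero mpoly \<Rightarrow> bool" where
  "homogeneous d p \<longleftrightarrow> (\<forall>m\<in>Poly_Mapping.keys p. monom_degree m = d)"

lemma monom_degree_add: "monom_degree (a + b) = monom_degree a + monom_degree b"
  unfolding monom_degree_def by (rule setsum_keys_plus_distrib) simp_all

lemma monom_degree_single [simp]: "monom_degree (Poly_Mapping.single v k) = k"
  by (simp add: monom_degree_def)

lemma monom_degree_le_total_degree:
  "m \<in> Poly_Mapping.keys p \<Longrightarrow> monom_degree m \<le> total_degree p"
  by (simp add: total_degree_def)

lemma homogeneous_const: "homogeneous 0 (const c)"
  by (simp add: homogeneous_def const_def monom_degree_def)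

lemma homogeneous_indet_poly: "homogeneous 1 (indet_poly v :: 'k::comm_ring_1 mpoly)"
  by (simp add: homogeneous_def indet_poly_def)

lemma homogeneous_add: "homogeneous d p \<Longrightarrow> homogeneous d q \<Longrightarrow> homogeneous d (p + q)"
  using keys_add[of p q] by (auto simp: homogeneous_def)

lemma homogeneous_mult:
  "homogeneous d p \<Longrightarrow> homogeneous e q \<Longrightarrow> homogeneous (d + e) (p * q :: 'k::comm_ring_1 mpoly)"
  using keys_mult[of p q] by (fastforce simp: homogeneous_def monom_degree_add)

lemma homogeneous_power:
  fixes p :: "'k::comm_ring_1 mpoly"
  assumes "homogeneous d p"
  shows "homogeneous (k * d) (p ^ k)"
proof (induction k)
  case 0
  show ?case using homogeneous_const[of 1] by simp
next
  case (Suc k)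
  then show ?case using homogeneous_mult[OF assms] by simp
qed

lemma homogeneous_sum:
  "(\<And>a. a \<in> A \<Longrightarrow> homogeneous d (f a)) \<Longrightarrow> homogeneous d (sum f A)"
  by (induction A rule: infinite_finite_induct)
     (auto intro: homogeneous_add simp: homogeneous_def[of _ 0])

lemma homogeneous_homogenize: "homogeneous (total_degree p) (homogenize p)"
  unfolding homogenize_def
  by (rule homogeneous_sum)
     (simp add: homogeneous_def monom_degree_add monom_degree_le_total_degree)

lemma indets_homogenize: "indets (homogenize p) \<subseteq> insert HVar (indets p)"
proof -
  have "indets (Poly_Mapping.single (m + Poly_Mapping.single HVar (total_degree p - monom_degree m))
          (Poly_Mapping.lookup p m)) \<subseteq> insert HVar (indets p)"
    if "m \<in> Poly_Mapping.keys p" for m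
    using that by (auto simp: indets_def keys_add_nat split: if_splits)
  then show ?thesis
    unfolding homogenize_def by (intro subset_trans[OF indets_sum] UN_least)
qed

lemma dehomogenize_homogenize:
  assumes "HVar \<notin> indets p"
  shows "dehomogenize (homogenize p) = p"
proof -
  let ?\<delta> = "\<lambda>v. if v = HVar then 1 else indet_poly v"
  have "dehomogenize (homogenize p) = mpoly_subst ?\<delta> p"
    by (simp add: dehomogenize_def homogenize_def mpoly_subst_sum mpoly_subst_single
        monom_subst_add monom_subst_single mpoly_subst_eq[of _ p])
  also have "\<dots> = p"
    by (rule mpoly_subst_id) (use assms in auto)
  finally show ?thesis .
qed

text \<open>Setting \<open>h = 1\<close> deletes the power of \<open>h\<close> from each monomial. Within a fixed degree that power
  is determined by the remaining exponents, so no two terms are merged and none can cancel.\<close>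

lemma homogeneous_dehomogenize_eq_0D:
  fixes p :: "'k::comm_ring_1 mpoly"
  assumes hom: "homogeneous d p" and zero: "dehomogenize p = 0"
  shows "p = 0"
proof -
  let ?\<delta> = "\<lambda>v. if v = HVar then 1 else indet_poly v :: 'k mpoly"
  define strip where "strip m = Poly_Mapping.update HVar 0 m" for m :: monom
  have split: "m = strip m + Poly_Mapping.single HVar (Poly_Mapping.lookup m HVar)" for m
    by (rule poly_mapping_eqI) (simp add: strip_def lookup_add lookup_update lookup_single when_def)
  have "monom_subst ?\<delta> (strip m) = monom_subst indet_poly (strip m)" for m
    unfolding monom_subst_def
    by (rule prod.cong) (auto simp: strip_def keys_update)
  then have "monom_subst ?\<delta> m = Poly_Mapping.single (strip m) 1" for m
    by (subst split) (simp add: monom_subst_add monom_subst_single monom_subst_indet_poly)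
  then have deh: "dehomogenize p =
      (\<Sum>m\<in>Poly_Mapping.keys p. Poly_Mapping.single (strip m) (Poly_Mapping.lookup p m))"
    by (simp add: dehomogenize_def mpoly_subst_eq const_def mult_single)
  have inj: "inj_on strip (Poly_Mapping.keys p)"
  proof (rule inj_onI)
    fix a b assume ab: "a \<in> Poly_Mapping.keys p" "b \<in> Poly_Mapping.keys p" "strip a = strip b"
    have "monom_degree (strip m) + Poly_Mapping.lookup m HVar = d" if "m \<in> Poly_Mapping.keys p" for m
      using hom that arg_cong[OF split[of m], of monom_degree]
      by (simp add: homogeneous_def monom_degree_add)
    from this[OF ab(1)] this[OF ab(2)] ab(3)
    have "Poly_Mapping.lookup a HVar = Poly_Mapping.lookup b HVar" by simp
    with ab(3) split[of a] split[of b] show "a = b" by simp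
  qed
  have "Poly_Mapping.lookup p a = 0" for a
  proof (rule ccontr)
    assume "Poly_Mapping.lookup p a \<noteq> 0"
    then have a: "a \<in> Poly_Mapping.keys p" by (simp add: in_keys_iff)
    have "0 = Poly_Mapping.lookup (dehomogenize p) (strip a)"
      by (simp add: zero)
    also have "\<dots> = (\<Sum>m\<in>Poly_Mapping.keys p. if m = a then Poly_Mapping.lookup p m else 0)"
      unfolding deh lookup_sum
      by (rule sum.cong) (use inj_onD[OF inj _ _ a] in \<open>auto simp: lookup_single when_def\<close>)
    also have "\<dots> = Poly_Mapping.lookup p a"
      using a by simp
    finally show False
      using \<open>Poly_Mapping.lookup p a \<noteq> 0\<close> by simp
  qed
  then show ?thesis
    by (intro poly_mapping_eqI) simp
qed

text \<open>The polynomial \<open>P\<close> is a homogenization of \<open>p\<close> for the grading in which \<open>v\<close> has weight \<open>w v\<close> and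
  \<open>HVar\<close> has weight \<open>1\<close>. Only the homogeneity of its image under \<open>\<sigma>\<close> matters, and asking just
  for existence allows an induction over the ring operations: homogenizations of two factors
  are multiplied, and those of two summands are first brought to the same degree by powers of
  \<open>HVar\<close>.\<close>

lemma weighted_homogenization_exists:
  fixes p :: "'k::comm_ring_1 mpoly"
  assumes p: "p \<in> carrier (poly_ring V)"
    and V: "HVar \<notin> V"
    and \<sigma>V: "\<And>v. v \<in> V \<Longrightarrow> homogeneous (w v) (\<sigma> v)"
    and \<sigma>H: "\<sigma> HVar = indet_poly HVar"
  obtains P d where "P \<in> carrier (poly_ring (V \<union> {HVar}))" "dehomogenize P = p"
    "homogeneous d (mpoly_subst \<sigma> P)"
proof -
  have "\<exists>P d. indets P \<subseteq> V \<union> {HVar} \<and> dehomogenize P = p \<and> homogeneous d (mpoly_subst \<sigma> P)"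
    using p
  proof (induction p rule: poly_ring_induct)
    case (const c)
    show ?case
      by (rule exI[of _ "const c"], rule exI[of _ 0])
         (simp add: dehomogenize_def homogeneous_const)
  next
    case (indet v)
    then show ?case
      by (intro exI[of _ "indet_poly v"] exI[of _ "w v"])
         (use V \<sigma>V in \<open>auto simp: dehomogenize_def\<close>)
  next
    case (add p q)
    then obtain P d Q e where
      P: "indets P \<subseteq> V \<union> {HVar}" "dehomogenize P = p" "homogeneous d (mpoly_subst \<sigma> P)" and
      Q: "indets Q \<subseteq> V \<union> {HVar}" "dehomogenize Q = q" "homogeneous e (mpoly_subst \<sigma> Q)"
      by blast
    let ?h = "indet_poly HVar :: 'k mpoly"
    have hpow: "homogeneous k (?h ^ k)" for k
      using homogeneous_power[OF homogeneous_indet_poly, of k HVar] by simp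
    have indets_h: "indets (?h ^ k * G) \<subseteq> V \<union> {HVar}" if "indets G \<subseteq> V \<union> {HVar}" for k G
      using that indets_mult[of "?h ^ k" G] indets_power[of ?h k] by auto
    show ?case
    proof (intro exI conjI)
      show "indets (?h ^ e * P + ?h ^ d * Q) \<subseteq> V \<union> {HVar}"
        using indets_add[of "?h ^ e * P" "?h ^ d * Q"] indets_h[OF P(1)] indets_h[OF Q(1)] by blast
      show "dehomogenize (?h ^ e * P + ?h ^ d * Q) = p + q"
        using P(2) Q(2)
        by (simp add: dehomogenize_def mpoly_subst_add mpoly_subst_mult mpoly_subst_power)
      show "homogeneous (d + e) (mpoly_subst \<sigma> (?h ^ e * P + ?h ^ d * Q))"
        using homogeneous_add[OF homogeneous_mult[OF hpow P(3), of e, unfolded add.commute[of e]]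
            homogeneous_mult[OF hpow Q(3), of d]]
        by (simp add: mpoly_subst_add mpoly_subst_mult mpoly_subst_power \<sigma>H)
    qed
  next
    case (mult p q)
    then obtain P d Q e where
      P: "indets P \<subseteq> V \<union> {HVar}" "dehomogenize P = p" "homogeneous d (mpoly_subst \<sigma> P)" and
      Q: "indets Q \<subseteq> V \<union> {HVar}" "dehomogenize Q = q" "homogeneous e (mpoly_subst \<sigma> Q)"
      by blast
    have "indets (P * Q) \<subseteq> V \<union> {HVar}"
      using indets_mult[of P Q] P(1) Q(1) by blast
    moreover have "dehomogenize (P * Q) = p * q"
      using P(2) Q(2) by (simp add: dehomogenize_def mpoly_subst_mult)
    moreover have "homogeneous (d + e) (mpoly_subst \<sigma> (P * Q))"
      using homogeneous_mult[OF P(3) Q(3)] by (simp add: mpoly_subst_mult)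
    ultimately show ?case by blast
  qed
  then show thesis using that by auto
qed

section \<open>Implicitization by homogenization\<close>

theorem proposition3p3:
  fixes f :: "nat \<Rightarrow> 'k::field mpoly" and n s :: nat
  assumes "\<And>i. i \<in> {1..n} \<Longrightarrow> f i \<in> carrier (poly_ring (tvars s)) - range const"
  defines "J \<equiv> eliminating_ideal n s (\<lambda>i. homogenize (f i))"
  defines "Ph \<equiv> poly_ring (xvars n \<union> {HVar}) :: 'k mpoly ring"
  shows "primeideal (J \<inter> carrier Ph) Ph \<and>
         implicit n s f = dehomogenize ` (J \<inter> carrier Ph)"
proof
  let ?\<Phi> = "graph_subst (\<lambda>i. homogenize (f i))"
  let ?\<phi> = "\<lambda>v. case v of XVar i \<Rightarrow> f i | _ \<Rightarrow> 0"
  let ?\<delta> = "\<lambda>v. if v = HVar then 1 else indet_poly v :: 'k mpoly"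
  have f: "indets (f i) \<subseteq> tvars s" if "i \<in> {1..n}" for i
    using assms(1)[OF that] by simp
  have "homogenize (f i) \<in> carrier (poly_ring (tvars s \<union> {HVar}))" if "i \<in> {1..n}" for i
    using indets_homogenize[of "f i"] f[OF that] by auto
  then have JPh: "J \<inter> carrier Ph = mpoly_subst_kernel (xvars n \<union> {HVar}) ?\<Phi>"
    unfolding J_def Ph_def
    by (subst eliminating_ideal_eq_kernel) (auto simp: mpoly_subst_kernel_def)
  show "primeideal (J \<inter> carrier Ph) Ph"
    by (subst JPh, subst Ph_def) (rule primeideal_mpoly_subst_kernel)
  have implicit: "implicit n s f = {p. indets p \<subseteq> xvars n \<and> mpoly_subst ?\<phi> p = 0}"
    by (simp add: implicit_def a_kernel_def')
  \<comment> \<open>The square formed by the two evaluations and the two dehomogenizations commutes.\<close>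
  have square: "mpoly_subst ?\<phi> (dehomogenize P) = dehomogenize (mpoly_subst ?\<Phi> P)"
    if "indets P \<subseteq> xvars n \<union> {HVar}" for P
    unfolding dehomogenize_def mpoly_subst_mpoly_subst
  proof (rule mpoly_subst_cong)
    fix v assume "v \<in> indets P"
    then consider (H) "v = HVar" | (X) i where "i \<in> {1..n}" "v = XVar i"
      using \<open>indets P \<subseteq> xvars n \<union> {HVar}\<close> by (auto simp: xvars_def)
    then show "mpoly_subst ?\<phi> (?\<delta> v) = mpoly_subst ?\<delta> (?\<Phi> v)"
    proof cases
      case H
      then show ?thesis by (simp add: graph_subst_def)
    next
      case X
      have "HVar \<notin> indets (f i)" using f[OF X(1)] by (auto simp: tvars_def)
      then have "mpoly_subst ?\<delta> (homogenize (f i)) = f i"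
        using dehomogenize_homogenize[of "f i"] by (simp add: dehomogenize_def)
      then show ?thesis using X by (simp add: graph_subst_def)
    qed
  qed
  show "implicit n s f = dehomogenize ` (J \<inter> carrier Ph)"
  proof
    show "dehomogenize ` (J \<inter> carrier Ph) \<subseteq> implicit n s f"
    proof
      fix p assume "p \<in> dehomogenize ` (J \<inter> carrier Ph)"
      then obtain P where P: "indets P \<subseteq> xvars n \<union> {HVar}" "mpoly_subst ?\<Phi> P = 0"
        and p: "p = dehomogenize P"
        by (auto simp: JPh mpoly_subst_kernel_def)
      have "dehomogenize P \<in> carrier (poly_ring (xvars n))"
        unfolding dehomogenize_def
        by (rule mpoly_subst_closed[where V = "xvars n \<union> {HVar}"]) (use P(1) in auto)
      moreover have "mpoly_subst ?\<phi> (dehomogenize P) = 0"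
        using square[OF P(1)] P(2) by (simp add: dehomogenize_def)
      ultimately show "p \<in> implicit n s f"
        by (simp add: implicit p)
    qed
    show "implicit n s f \<subseteq> dehomogenize ` (J \<inter> carrier Ph)"
    proof
      fix p assume "p \<in> implicit n s f"
      then have p: "p \<in> carrier (poly_ring (xvars n))" "mpoly_subst ?\<phi> p = 0"
        by (simp_all add: implicit)
      obtain P d where P: "P \<in> carrier (poly_ring (xvars n \<union> {HVar}))" "dehomogenize P = p"
        "homogeneous d (mpoly_subst ?\<Phi> P)"
      proof (rule weighted_homogenization_exists[OF p(1), where \<sigma> = ?\<Phi> and
            w = "\<lambda>v. case v of XVar i \<Rightarrow> total_degree (f i) | _ \<Rightarrow> 0"])
        show "homogeneous (case v of XVar i \<Rightarrow> total_degree (f i) | _ \<Rightarrow> 0) (?\<Phi> v)"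
          if "v \<in> xvars n" for v
          using that by (auto simp: xvars_def graph_subst_def homogeneous_homogenize)
      qed (auto simp: xvars_def graph_subst_def)
      have "dehomogenize (mpoly_subst ?\<Phi> P) = 0"
        using square[of P] P(1,2) p(2) by simp
      then have "mpoly_subst ?\<Phi> P = 0"
        by (rule homogeneous_dehomogenize_eq_0D[OF P(3)])
      then show "p \<in> dehomogenize ` (J \<inter> carrier Ph)"
        using P(1,2) by (auto simp: JPh mpoly_subst_kernel_def)
    qed
  qed
qed

end
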